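(* Let $k$ be a field, let $A$ be a unital associative (not necessarily commutative) $k$-algebra, let $u\in A$ be a separable element, and let $p=p_1^{m_1}\cdots p_r^{m_r}\in k[x]$ be a monic annihilating polynomial of $u$, where $p_1,\dots,p_r$ are the distinct monic irreducible factors of $p$ (with $m_j\ge 1$), all of which are assumed to be separable polynomials. Set $m=\max_{1\le j\le r}m_j$, $\tilde p=p_1\cdots p_r$ and $\overline p=p/\tilde p$. Then $\tilde p$ is separable, and there exists $q\in k[x]$ such that $q\,\tilde p'\equiv 1 \pmod{\overline p}$. For any such $q$, define a sequence $(d_n)_{n\ge 0}$ of elements of $A$ by $$d_0=u,\qquad d_{n+1}=d_n-\tilde p(d_n)\,q(d_n)\quad (n\ge 0),$$ and let $N$ be the smallest integer such that $2^N\ge m$. Then $\tilde p(d_N)=0$, $d_N$ is absolutely semisimple, $u-d_N$ is nilpotent, $[d_N,u-d_N]=0$, and $(d_N,u-d_N)$ is the unique Jordan-Chevalley decomposition of $u$ in $A$.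
   Context: Fields are commutative. A non-constant polynomial $f\in k[x]$ is called separable if it is coprime to its formal derivative $f'$. For $A$ a unital $k$-algebra with unit $1_A$, $u,v\in A$ and $f=f_0+f_1x+\dots+f_nx^n\in k[x]$, write $[u,v]=uv-vu$ and $f(u)=f_0 1_A+f_1u+\dots+f_nu^n$; $f$ is an annihilating polynomial of $u$ if $f(u)=0$. Irreducible factors of a polynomial are taken to be monic. An element $u\in A$ is absolutely semisimple if it has an annihilating polynomial that is separable. An element $u\in A$ is separable if it has a (nonzero) annihilating polynomial in $k[x]$ all of whose irreducible factors are separable polynomials. A Jordan-Chevalley decomposition of $u\in A$ is a pair $(d,s)$ of elements of $A$ with $d$ absolutely semisimple, $s$ nilpotent, $u=d+s$ and $[d,s]=0$. *)

theory Defs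
  imports "HOL-Computational_Algebra.Polynomial" "HOL-Number_Theory.Cong"
begin

text \<open>The sort \<open>{ring, monoid_mult}\<close> is used instead of \<open>ring_1\<close>, whose axiom
  \<open>0 \<noteq> 1\<close> would exclude the zero algebra.\<close>

locale unital_algebra = vector_space scale
  for scale :: "'k::field \<Rightarrow> 'a::{ring, monoid_mult} \<Rightarrow> 'a" +
  assumes scale_mult_left: "scale c x * y = scale c (x * y)"
    and scale_mult_right: "x * scale c y = scale c (x * y)"

definition alg_eval :: "('k::field \<Rightarrow> 'a::{ring, monoid_mult} \<Rightarrow> 'a) \<Rightarrow> 'k poly \<Rightarrow> 'a \<Rightarrow> 'a" where
  "alg_eval scale f u = (\<Sum>i\<le>degree f. scale (coeff f i) (u ^ i))"

definition separable_poly :: "'k::field poly \<Rightarrow> bool" where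
  "separable_poly f \<longleftrightarrow> degree f > 0 \<and> coprime f (pderiv f)"

definition commutator :: "'a::ring \<Rightarrow> 'a \<Rightarrow> 'a" where
  "commutator u v = u * v - v * u"

definition nilpotent :: "'a::{ring, monoid_mult} \<Rightarrow> bool" where
  "nilpotent s \<longleftrightarrow> (\<exists>n>0. s ^ n = 0)"

definition absolutely_semisimple ::
  "('k::field \<Rightarrow> 'a::{ring, monoid_mult} \<Rightarrow> 'a) \<Rightarrow> 'a \<Rightarrow> bool" where
  "absolutely_semisimple scale u \<longleftrightarrow> (\<exists>f. separable_poly f \<and> alg_eval scale f u = 0)"

definition separable_element ::
  "('k::field \<Rightarrow> 'a::{ring, monoid_mult} \<Rightarrow> 'a) \<Rightarrow> 'a \<Rightarrow> bool" where
  "separable_element scale u \<longleftrightarrow>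
     (\<exists>f. f \<noteq> 0 \<and> alg_eval scale f u = 0 \<and>
          (\<forall>g. irreducible g \<and> lead_coeff g = 1 \<and> g dvd f \<longrightarrow> separable_poly g))"

definition Jordan_Chevalley ::
  "('k::field \<Rightarrow> 'a::{ring, monoid_mult} \<Rightarrow> 'a) \<Rightarrow> 'a \<Rightarrow> 'a \<Rightarrow> 'a \<Rightarrow> bool" where
  "Jordan_Chevalley scale u d s \<longleftrightarrow>
     absolutely_semisimple scale d \<and> nilpotent s \<and> u = d + s \<and> commutator d s = 0"

primrec newton_seq ::
  "('k::field \<Rightarrow> 'a::{ring, monoid_mult} \<Rightarrow> 'a) \<Rightarrow> 'k poly \<Rightarrow> 'k poly \<Rightarrow> 'a \<Rightarrow> nat \<Rightarrow> 'a" where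
  "newton_seq scale f q u 0 = u"
| "newton_seq scale f q u (Suc n) =
     newton_seq scale f q u n
       - alg_eval scale f (newton_seq scale f q u n) * alg_eval scale q (newton_seq scale f q u n)"

end

theory Submission
  imports Defs "HOL-Computational_Algebra.Squarefree"
begin

text \<open>
  The iteration can be run in \<open>k[x]\<close>, starting from \<open>x\<close>, and evaluated at \<open>u\<close> afterwards. There
  \<open>D\<^sub>n \<equiv> x\<close> modulo \<open>p~\<close>, so \<open>p\<close> divides \<open>p(D\<^sub>n)\<close>: split off common factors with \<open>p~\<close>
  repeatedly. Writing \<open>1 - q p~' = p\<^sub>b h\<close> with \<open>p\<^sub>b = p / p~\<close>, Taylor's formula gives
  \<open>p~(D\<^sub>n\<^sub>+\<^sub>1) \<equiv> p(D\<^sub>n) h(D\<^sub>n)\<close> modulo \<open>p~(D\<^sub>n)\<^sup>2\<close>, hence modulo \<open>p\<close> the polynomial \<open>p~(D\<^sub>n)\<close>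
  is a multiple of \<open>p~\<close> to the power \<open>2\<^sup>n\<close>, and \<open>p\<close> divides the latter for \<open>n = N\<close>.

  For uniqueness, let \<open>d'\<close> be the semisimple part of another decomposition. It commutes with
  \<open>d\<^sub>N\<close>, a polynomial in \<open>u\<close>, and \<open>e = d' - d\<^sub>N\<close> is nilpotent. Thus \<open>p~(d')\<close> is nilpotent, and it
  vanishes because a squarefree polynomial annihilates \<open>d'\<close>. Taylor's formula now reads
  \<open>0 = e p~'(d\<^sub>N) + e\<^sup>2 w\<close> with \<open>p~'(d\<^sub>N)\<close> invertible, which forces \<open>e = 0\<close>.
\<close>

section \<open>Coprimality in Euclidean rings\<close>

text \<open>The \<open>gcd\<close> library does not apply to polynomials over a type of class \<open>field\<close>; it requires
  \<open>field_gcd\<close>.\<close>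

lemma bezout_cofactors:
  fixes a b :: "'a::euclidean_ring"
  shows "\<exists>t a' b' x y. a = t * a' \<and> b = t * b' \<and> x * a' + y * b' = 1"
proof (induction "euclidean_size b" arbitrary: a b rule: less_induct)
  case less
  show ?case
  proof (cases "b = 0")
    case True
    then show ?thesis by (intro exI[of _ a] exI[of _ 1] exI[of _ 0]) simp
  next
    case False
    then obtain t b' r' x y
      where b: "b = t * b'" and r: "a mod b = t * r'" and xy: "x * b' + y * r' = 1"
      using less[of "a mod b" b] mod_size_less by blast
    have "a = t * (b' * (a div b) + r')"
      using mult_div_mod_eq[of b a] by (simp add: b[symmetric] r distrib_left flip: mult.assoc)
    moreover have "y * (b' * (a div b) + r') + (x - y * (a div b)) * b' = 1"
      using xy by (simp add: algebra_simps)
    ultimately show ?thesis using b by blast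
  qed
qed

lemma coprime_iff_bezout:
  fixes a b :: "'a::euclidean_ring"
  shows "coprime a b \<longleftrightarrow> (\<exists>x y. x * a + y * b = 1)"
proof
  assume "coprime a b"
  obtain t a' b' x y where ab: "a = t * a'" "b = t * b'" and xy: "x * a' + y * b' = 1"
    using bezout_cofactors[of a b] by blast
  have "is_unit t" using \<open>coprime a b\<close> by (rule coprime_common_divisor) (simp_all add: ab)
  then obtain k where "1 = t * k" by (auto elim: dvdE)
  have "(k * x) * a + (k * y) * b = (t * k) * (x * a' + y * b')"
    by (simp add: ab algebra_simps)
  then have "(k * x) * a + (k * y) * b = 1" using xy \<open>1 = t * k\<close> by simp
  then show "\<exists>x y. x * a + y * b = 1" by blast
next
  assume "\<exists>x y. x * a + y * b = 1"
  then show "coprime a b" by (metis coprimeI dvd_add dvd_mult)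
qed

lemma coprime_mult_rightI:
  fixes a b c :: "'a::euclidean_ring"
  assumes "coprime a b" "coprime a c"
  shows "coprime a (b * c)"
proof -
  obtain x y z w where xy: "x * a + y * b = 1" and zw: "z * a + w * c = 1"
    using assms by (auto simp: coprime_iff_bezout)
  have "(x * z * a + x * w * c + y * b * z) * a + (y * w) * (b * c)
      = (x * a + y * b) * (z * a + w * c)"
    by (simp add: algebra_simps)
  then show ?thesis unfolding coprime_iff_bezout using xy zw by (metis mult_1)
qed

lemma coprime_power_rightI:
  fixes a b :: "'a::euclidean_ring"
  shows "coprime a b \<Longrightarrow> coprime a (b ^ n)"
  by (induction n) (simp_all add: coprime_mult_rightI)

lemma coprime_prod_rightI:
  fixes a :: "'a::euclidean_ring"
  shows "(\<And>j. j \<in> J \<Longrightarrow> coprime a (f j)) \<Longrightarrow> coprime a (prod f J)"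
  by (induction J rule: infinite_finite_induct) (simp_all add: coprime_mult_rightI)

lemma coprime_dvd_multD:
  fixes a b c :: "'a::euclidean_ring"
  assumes "coprime a b" "a dvd b * c"
  shows "a dvd c"
proof -
  obtain x y where "x * a + y * b = 1" using assms(1) by (auto simp: coprime_iff_bezout)
  then have "c = (x * a + y * b) * c" by simp
  also have "\<dots> = a * (x * c) + (b * c) * y" by (simp add: algebra_simps)
  also have "a dvd \<dots>" using assms(2) by (rule dvd_add[OF dvd_triv_left dvd_mult2])
  finally show ?thesis .
qed

lemma coprime_mult_add_right_iff:
  fixes a b c :: "'a::algebraic_semidom"
  shows "coprime a (a * c + b) \<longleftrightarrow> coprime a b"
  unfolding coprime_def by (metis dvd_add_right_iff dvd_mult2)

lemma squarefree_dvd_power_imp_dvd: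
  fixes a b :: "'a::euclidean_ring"
  assumes "squarefree a" "a dvd b ^ n"
  shows "a dvd b"
proof -
  obtain t a' b' x y where a: "a = t * a'" and b: "b = t * b'" and "x * a' + y * b' = 1"
    using bezout_cofactors[of a b] by blast
  then have "coprime a' b'" using coprime_iff_bezout by blast
  moreover have "coprime a' t"
  proof (rule coprimeI)
    fix c assume "c dvd a'" "c dvd t"
    then have "c\<^sup>2 dvd a" by (simp add: a power2_eq_square mult_dvd_mono)
    then show "is_unit c" using assms(1) by (rule squarefreeD[rotated])
  qed
  ultimately have "coprime a' (b ^ n)"
    unfolding b by (intro coprime_power_rightI coprime_mult_rightI)
  moreover have "a' dvd b ^ n" using assms(2) a dvd_mult_right by blast
  ultimately have "is_unit a'" by (simp add: coprime_absorb_left)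
  then show ?thesis by (simp add: a b unit_imp_dvd)
qed

section \<open>Separable polynomials\<close>

lemma separable_poly_imp_squarefree:
  assumes "separable_poly f"
  shows "squarefree f"
proof (rule squarefreeI)
  fix c assume "c\<^sup>2 dvd f"
  then obtain k where f: "f = c * (c * k)" by (metis dvdE mult.assoc power2_eq_square)
  then have "c dvd f" "c dvd pderiv f" by (simp_all add: pderiv_mult)
  then show "is_unit c"
    using assms coprime_common_divisor unfolding separable_poly_def by blast
qed

lemma separable_poly_mult:
  assumes "separable_poly f" "separable_poly g" "coprime f g"
  shows "separable_poly (f * g)"
proof -
  have "coprime f (g * pderiv f)" "coprime g (f * pderiv g)"
    using assms by (auto simp: separable_poly_def coprime_commute intro!: coprime_mult_rightI)
  then have "coprime f (f * pderiv g + g * pderiv f)" "coprime g (g * pderiv f + f * pderiv g)"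
    by (simp_all only: coprime_mult_add_right_iff)
  then have "coprime f (pderiv (f * g))" "coprime g (pderiv (f * g))"
    by (simp_all add: pderiv_mult add.commute)
  then have "coprime (f * g) (pderiv (f * g))"
    by (metis coprime_commute coprime_mult_rightI)
  moreover have "f \<noteq> 0" "g \<noteq> 0" using assms by (auto simp: separable_poly_def)
  then have "degree (f * g) > 0" using assms by (simp add: separable_poly_def degree_mult_eq)
  ultimately show ?thesis by (simp add: separable_poly_def)
qed

lemma separable_poly_prod:
  assumes "finite J" "J \<noteq> {}" "\<And>j. j \<in> J \<Longrightarrow> separable_poly (f j)"
    and "\<And>i j. i \<in> J \<Longrightarrow> j \<in> J \<Longrightarrow> i \<noteq> j \<Longrightarrow> coprime (f i) (f j)"
  shows "separable_poly (prod f J)"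
  using assms
proof (induction J rule: finite_ne_induct)
  case (singleton i)
  then show ?case by simp
next
  case (insert i J)
  have "coprime (f i) (prod f J)"
    using insert.hyps insert.prems by (intro coprime_prod_rightI) auto
  then show ?case using insert by (simp add: separable_poly_mult)
qed

lemma separable_poly_ex_inverse_pderiv_cong:
  assumes "separable_poly f" "g dvd f ^ m"
  shows "\<exists>q. [q * pderiv f = 1] (mod g)"
proof -
  have "coprime (pderiv f) (f ^ m)"
    using assms(1) by (intro coprime_power_rightI) (simp add: separable_poly_def coprime_commute)
  then have "coprime (pderiv f) g" by (rule coprime_divisors[OF dvd_refl assms(2)])
  then obtain q y where "q * pderiv f + y * g = 1" by (auto simp: coprime_iff_bezout)
  then have "1 = q * pderiv f + g * y" by (simp add: mult.commute)
  then show ?thesis using cong_iff_lin by blast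
qed

lemma monic_dvd_irreducible_imp_eq:
  fixes f g :: "'a::idom_divide poly"
  assumes "irreducible g" "f dvd g" "\<not> is_unit f" "lead_coeff f = 1" "lead_coeff g = 1"
  shows "f = g"
proof -
  obtain k where k: "g = f * k" using assms(2) by (elim dvdE)
  then have "is_unit k" using assms(1,3) irreducibleD by blast
  then obtain c where "k = [:c:]" by (auto elim: is_unit_polyE)
  moreover have "lead_coeff k = 1" using assms(4,5) by (simp add: k lead_coeff_mult)
  ultimately show ?thesis by (simp add: k)
qed

lemma coprime_monic_irreducible:
  fixes f g :: "'a::idom_divide poly"
  assumes "irreducible f" "irreducible g" "lead_coeff f = 1" "lead_coeff g = 1" "f \<noteq> g"
  shows "coprime f g"
proof (rule coprimeI, rule ccontr)
  fix c assume c: "c dvd f" "c dvd g" "\<not> is_unit c"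
  then have "f dvd g" using assms(1) irreducibleD' dvd_trans by blast
  moreover have "\<not> is_unit f" using assms(1) irreducible_not_unit by blast
  ultimately show False using assms monic_dvd_irreducible_imp_eq by blast
qed

section \<open>Evaluation in an algebra\<close>

context unital_algebra
begin

lemma alg_eval_0: "alg_eval scale 0 u = 0"
  by (simp add: alg_eval_def)

lemma alg_eval_eq_sum:
  assumes "degree f \<le> n"
  shows "alg_eval scale f u = (\<Sum>i\<le>n. scale (coeff f i) (u ^ i))"
  unfolding alg_eval_def
  using assms by (intro sum.mono_neutral_left) (auto simp: coeff_eq_0)

lemma alg_eval_pCons: "alg_eval scale (pCons a f) u = scale a 1 + u * alg_eval scale f u"
proof -
  have "alg_eval scale (pCons a f) u = (\<Sum>i\<le>Suc (degree f). scale (coeff (pCons a f) i) (u ^ i))"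
    by (rule alg_eval_eq_sum) (simp add: degree_pCons_le)
  also have "\<dots> = scale a 1 + (\<Sum>i\<le>degree f. scale (coeff f i) (u * u ^ i))"
    by (subst sum.atMost_Suc_shift) simp
  also have "\<dots> = scale a 1 + u * alg_eval scale f u"
    by (simp add: alg_eval_def sum_distrib_left scale_mult_right)
  finally show ?thesis .
qed

lemma alg_eval_1: "alg_eval scale 1 u = 1"
  by (simp add: one_pCons alg_eval_pCons alg_eval_0)

lemma alg_eval_X: "alg_eval scale [:0, 1:] u = u"
  by (simp add: alg_eval_pCons alg_eval_0)

lemma alg_eval_add: "alg_eval scale (f + g) u = alg_eval scale f u + alg_eval scale g u"
  by (induction f g rule: poly_induct2)
    (simp_all add: alg_eval_0 alg_eval_pCons scale_left_distrib algebra_simps)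

lemma alg_eval_smult: "alg_eval scale (smult c f) u = scale c (alg_eval scale f u)"
  by (induction f)
    (simp_all add: alg_eval_0 alg_eval_pCons scale_right_distrib scale_mult_right)

lemma alg_eval_diff: "alg_eval scale (f - g) u = alg_eval scale f u - alg_eval scale g u"
  using alg_eval_add[of "f - g" g u] by simp

lemma alg_eval_mult: "alg_eval scale (f * g) u = alg_eval scale f u * alg_eval scale g u"
  by (induction f)
    (simp_all add: alg_eval_0 alg_eval_pCons alg_eval_add alg_eval_smult scale_mult_left
      distrib_right mult.assoc)

lemma alg_eval_power: "alg_eval scale (f ^ n) u = alg_eval scale f u ^ n"
  by (induction n) (simp_all add: alg_eval_1 alg_eval_mult)

lemma alg_eval_pcompose: "alg_eval scale (pcompose f g) u = alg_eval scale f (alg_eval scale g u)"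
  by (induction f)
    (simp_all add: alg_eval_0 alg_eval_pCons pcompose_pCons alg_eval_add alg_eval_mult)

lemma alg_eval_dvd_eq_0:
  assumes "alg_eval scale f u = 0" "f dvd g"
  shows "alg_eval scale g u = 0"
  using assms by (auto elim!: dvdE simp: alg_eval_mult)

lemma alg_eval_commute:
  assumes "v * u = u * v"
  shows "v * alg_eval scale f u = alg_eval scale f u * v"
proof (induction f)
  case 0
  then show ?case by (simp add: alg_eval_0)
next
  case (pCons a f)
  have "v * (u * alg_eval scale f u) = u * alg_eval scale f u * v"
    by (metis assms mult.assoc pCons.IH)
  then show ?case
    by (simp add: alg_eval_pCons distrib_left distrib_right scale_mult_left scale_mult_right)
qed

lemma alg_eval_taylor:
  assumes "x * y = y * x"
  shows "\<exists>w. y * w = w * y \<and> alg_eval scale f (x + y)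
    = alg_eval scale f x + y * alg_eval scale (pderiv f) x + y\<^sup>2 * w"
proof (induction f)
  case 0
  show ?case by (intro exI[of _ 0]) (simp add: alg_eval_0)
next
  case (pCons a f)
  then obtain w where yw: "y * w = w * y" and w: "alg_eval scale f (x + y)
    = alg_eval scale f x + y * alg_eval scale (pderiv f) x + y\<^sup>2 * w" by blast
  define F G where "F = alg_eval scale f x" and "G = alg_eval scale (pderiv f) x"
  have xy: "x * (y * z) = y * (x * z)" and wy: "w * (y * z) = y * (w * z)" for z
    by (metis assms mult.assoc) (metis yw mult.assoc)
  have "alg_eval scale (pCons a f) (x + y)
      = alg_eval scale (pCons a f) x + y * (F + x * G) + y\<^sup>2 * (x * w + G + y * w)"
    by (simp add: alg_eval_pCons w power2_eq_square algebra_simps xy flip: F_def G_def)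
  moreover have "F + x * G = alg_eval scale (pderiv (pCons a f)) x"
    by (simp add: pderiv_pCons alg_eval_add alg_eval_pCons F_def G_def)
  moreover have "y * G = G * y" unfolding G_def using assms by (intro alg_eval_commute) simp
  then have "y * (x * w + G + y * w) = (x * w + G + y * w) * y"
    by (simp add: distrib_left distrib_right mult.assoc xy wy flip: yw)
  ultimately show ?case by auto
qed

end

section \<open>The Newton iteration in the polynomial ring\<close>

lemma unital_algebra_smult: "unital_algebra (smult :: 'k::field \<Rightarrow> 'k poly \<Rightarrow> 'k poly)"
  by unfold_locales (simp_all add: smult_add_right smult_add_left)

lemma alg_eval_smult_eq_pcompose: "alg_eval smult f g = pcompose f g"
proof -
  interpret poly: unital_algebra "smult :: 'a \<Rightarrow> 'a poly \<Rightarrow> 'a poly" by (rule unital_algebra_smult)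
  show ?thesis
    by (induction f) (simp_all add: poly.alg_eval_0 poly.alg_eval_pCons pcompose_pCons)
qed

lemma pcompose_taylor:
  fixes f x y :: "'k::field poly"
  shows "\<exists>w. pcompose f (x + y) = pcompose f x + y * pcompose (pderiv f) x + y\<^sup>2 * w"
proof -
  interpret poly: unital_algebra "smult :: 'k \<Rightarrow> 'k poly \<Rightarrow> 'k poly" by (rule unital_algebra_smult)
  show ?thesis
    using poly.alg_eval_taylor[of x y f] by (auto simp: alg_eval_smult_eq_pcompose mult.commute)
qed

lemma cong_pcompose:
  fixes f :: "'k::field poly"
  assumes "[a = b] (mod c)"
  shows "[pcompose f a = pcompose f b] (mod c)"
  by (induction f) (auto simp: pcompose_pCons intro!: cong_add cong_mult assms)

lemma dvd_pcompose_self: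
  fixes p f D :: "'k::field poly"
  assumes "[D = [:0, 1:]] (mod f)" "p dvd f ^ m"
  shows "p dvd pcompose p D"
  using assms(2)
proof (induction m arbitrary: p)
  case 0
  then show ?case by (simp add: unit_imp_dvd)
next
  case (Suc m)
  obtain t p' f' x y where p: "p = t * p'" and f: "f = t * f'" and "x * p' + y * f' = 1"
    using bezout_cofactors[of p f] by blast
  then have coprime: "coprime p' f'" using coprime_iff_bezout by blast
  show ?case
  proof (cases "t = 0")
    case True
    then show ?thesis by (simp add: p)
  next
    case False
    have "t * p' dvd t * (f' * f ^ m)" using Suc.prems by (simp add: p f mult.assoc)
    then have "p' dvd f' * f ^ m" using False by simp
    then have "p' dvd pcompose p' D" by (rule Suc.IH[OF coprime_dvd_multD[OF coprime]])
    moreover have "[D = [:0, 1:]] (mod t)" by (rule cong_dvd_modulus[OF assms(1)]) (simp add: f)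
    then have "[pcompose t D = pcompose t [:0, 1:]] (mod t)" by (rule cong_pcompose)
    then have "t dvd pcompose t D" by (simp add: cong_dvd_iff)
    ultimately show ?thesis by (simp add: p pcompose_mult mult_dvd_mono)
  qed
qed

definition newton_poly :: "'k::field poly \<Rightarrow> 'k poly \<Rightarrow> nat \<Rightarrow> 'k poly" where
  "newton_poly f q n = newton_seq smult f q [:0, 1:] n"

lemma newton_poly_0: "newton_poly f q 0 = [:0, 1:]"
  by (simp add: newton_poly_def)

lemma newton_poly_Suc:
  "newton_poly f q (Suc n) = newton_poly f q n
    - pcompose f (newton_poly f q n) * pcompose q (newton_poly f q n)"
  by (simp add: newton_poly_def alg_eval_smult_eq_pcompose)

lemma newton_poly_cong_X: "[newton_poly f q n = [:0, 1:]] (mod f)"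
proof (induction n)
  case 0
  then show ?case by (simp add: newton_poly_0)
next
  case (Suc n)
  let ?D = "newton_poly f q n"
  have "[pcompose f ?D = pcompose f [:0, 1:]] (mod f)" by (rule cong_pcompose[OF Suc])
  then have "[pcompose f ?D = 0] (mod f)" by (simp add: cong_def)
  then have "[?D - pcompose f ?D * pcompose q ?D = [:0, 1:] - 0 * pcompose q ?D] (mod f)"
    by (intro cong_diff cong_mult Suc cong_refl)
  then show ?case by (simp add: newton_poly_Suc)
qed

lemma newton_step_pcompose:
  fixes f g q D :: "'k::field poly"
  assumes "[q * pderiv f = 1] (mod g)"
  shows "\<exists>v w. pcompose f (D - pcompose f D * pcompose q D)
    = pcompose (f * g) D * v + (pcompose f D)\<^sup>2 * w"
proof -
  let ?F = "pcompose f D" and ?Q = "pcompose q D"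
  obtain h where h: "1 = q * pderiv f + g * h" using assms by (auto simp: cong_iff_lin)
  obtain w where "pcompose f (D + - (?F * ?Q))
      = ?F + - (?F * ?Q) * pcompose (pderiv f) D + (- (?F * ?Q))\<^sup>2 * w"
    using pcompose_taylor by blast
  then have "pcompose f (D - ?F * ?Q)
      = ?F * pcompose (1 - q * pderiv f) D + ?F\<^sup>2 * (?Q\<^sup>2 * w)"
    by (simp add: pcompose_diff pcompose_mult pcompose_1 power2_eq_square algebra_simps)
  also have "1 - q * pderiv f = g * h" using h by (simp add: algebra_simps)
  also have "?F * pcompose (g * h) D = pcompose (f * g) D * pcompose h D"
    by (simp add: pcompose_mult mult.assoc)
  finally show ?thesis by blast
qed

lemma pcompose_newton_poly_cong:
  assumes "f * g dvd f ^ m" "[q * pderiv f = 1] (mod g)"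
  shows "\<exists>c. [pcompose f (newton_poly f q n) = f ^ (2 ^ n) * c] (mod (f * g))"
proof (induction n)
  case 0
  show ?case by (intro exI[of _ 1]) (simp add: newton_poly_0)
next
  case (Suc n)
  define D where "D = newton_poly f q n"
  obtain c where c: "[pcompose f D = f ^ (2 ^ n) * c] (mod (f * g))"
    using Suc unfolding D_def by blast
  obtain v w where step: "pcompose f (newton_poly f q (Suc n))
      = pcompose (f * g) D * v + (pcompose f D)\<^sup>2 * w"
    using newton_step_pcompose[OF assms(2)] unfolding newton_poly_Suc D_def by blast
  have "f * g dvd pcompose (f * g) D"
    unfolding D_def using newton_poly_cong_X assms(1) by (rule dvd_pcompose_self)
  then have "[pcompose (f * g) D = 0] (mod (f * g))" by (simp add: cong_0_iff)
  then have "[pcompose f (newton_poly f q (Suc n))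
      = 0 * v + (f ^ (2 ^ n) * c)\<^sup>2 * w] (mod (f * g))"
    unfolding step by (intro cong_add cong_mult cong_pow c cong_refl)
  also have "0 * v + (f ^ (2 ^ n) * c)\<^sup>2 * w = f ^ (2 ^ Suc n) * (c\<^sup>2 * w)"
    by (simp add: power_mult_distrib mult.assoc mult.commute[of 2 "2 ^ n"] power_mult)
  finally show ?case by blast
qed

lemma (in unital_algebra) newton_seq_eq_alg_eval:
  "newton_seq scale f q u n = alg_eval scale (newton_poly f q n) u"
  by (induction n)
    (simp_all add: newton_poly_0 newton_poly_Suc alg_eval_X alg_eval_diff alg_eval_mult
      alg_eval_pcompose)

section \<open>Nilpotent elements\<close>

lemma power_mult_distrib_commuting:
  fixes a b :: "'a::monoid_mult"
  assumes "a * b = b * a"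
  shows "(a * b) ^ n = a ^ n * b ^ n"
proof (induction n)
  case 0
  show ?case by simp
next
  case (Suc n)
  have "b * a ^ n = a ^ n * b" using assms by (metis power_commuting_commutes)
  then have "a * b * (a ^ n * b ^ n) = a * a ^ n * (b * b ^ n)" by (metis mult.assoc)
  then show ?case using Suc by simp
qed

lemma nilpotent_mult_commuting:
  assumes "nilpotent a" "a * b = b * a"
  shows "nilpotent (a * b)"
  using assms unfolding nilpotent_def by (metis power_mult_distrib_commuting mult_zero_left)

lemma power_add_commuting_ex:
  fixes a b :: "'a::{ring, monoid_mult}"
  assumes "a * b = b * a"
  shows "\<exists>c. b * c = c * b \<and> (a + b) ^ n = a ^ n + b * c"
proof (induction n)
  case 0
  show ?case by (intro exI[of _ 0]) simp
next
  case (Suc n)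
  then obtain c where bc: "b * c = c * b" and c: "(a + b) ^ n = a ^ n + b * c" by blast
  let ?c = "a ^ n + (a + b) * c"
  have "(a + b) ^ Suc n = a ^ Suc n + b * ?c"
    by (simp add: c distrib_left distrib_right assms flip: mult.assoc)
  moreover have "b * a ^ n = a ^ n * b" using assms by (metis power_commuting_commutes)
  then have "b * ?c = ?c * b"
    using bc assms by (simp add: distrib_left distrib_right mult.assoc) (metis mult.assoc)
  ultimately show ?case by blast
qed

lemma nilpotent_diff_commuting:
  fixes a b :: "'a::{ring, monoid_mult}"
  assumes "nilpotent a" "nilpotent b" "a * b = b * a"
  shows "nilpotent (a - b)"
proof -
  obtain m where m: "m > 0" "a ^ m = 0" using assms(1) by (auto simp: nilpotent_def)
  obtain c where "- b * c = c * - b" and c: "(a - b) ^ m = - b * c"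
    using power_add_commuting_ex[of a "- b" m] assms(3) m by auto
  then have "nilpotent ((a - b) ^ m)"
    using nilpotent_mult_commuting[OF assms(2), of "- c"] by simp
  then show ?thesis
    using m(1) unfolding nilpotent_def by (metis nat_0_less_mult_iff power_mult)
qed

lemma nilpotent_eq_0_if_eq_square_mult:
  assumes "nilpotent e" "e = e\<^sup>2 * z"
  shows "e = 0"
proof -
  have "e = e ^ Suc n * z ^ n" for n
  proof (induction n)
    case 0
    show ?case by simp
  next
    case (Suc n)
    have "e ^ Suc n = e ^ Suc (Suc n) * z"
      using assms(2) by (metis mult.assoc power_Suc2 power2_eq_square)
    then show ?case using Suc by (metis mult.assoc power_Suc)
  qed
  moreover obtain n where "e ^ n = 0" using assms(1) by (auto simp: nilpotent_def)
  ultimately show ?thesis by (metis mult_zero_left mult_zero_right power_Suc)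
qed

section \<open>The Jordan-Chevalley decomposition\<close>

context unital_algebra
begin

lemma alg_eval_newton_seq_eq_0:
  assumes "alg_eval scale (f * g) u = 0" "f * g dvd f ^ (2 ^ n)" "[q * pderiv f = 1] (mod g)"
  shows "alg_eval scale f (newton_seq scale f q u n) = 0"
proof -
  obtain c where "[pcompose f (newton_poly f q n) = f ^ (2 ^ n) * c] (mod (f * g))"
    using pcompose_newton_poly_cong assms(2,3) by blast
  then have "f * g dvd pcompose f (newton_poly f q n)"
    using assms(2) by (metis cong_dvd_iff dvd_mult2)
  then have "alg_eval scale (pcompose f (newton_poly f q n)) u = 0"
    using assms(1) alg_eval_dvd_eq_0 by blast
  then show ?thesis by (simp add: alg_eval_pcompose newton_seq_eq_alg_eval)
qed

lemma nilpotent_diff_newton_seq: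
  assumes "alg_eval scale p u = 0" "p dvd f ^ m"
  shows "nilpotent (u - newton_seq scale f q u n)"
proof -
  have "f dvd [:0, 1:] - newton_poly f q n"
    using newton_poly_cong_X[of f q n] by (metis cong_iff_dvd_diff cong_sym)
  then have "f ^ m dvd ([:0, 1:] - newton_poly f q n) ^ Suc m"
    by (intro dvd_trans[OF dvd_power_same le_imp_power_dvd]) simp_all
  then have "alg_eval scale (([:0, 1:] - newton_poly f q n) ^ Suc m) u = 0"
    using assms alg_eval_dvd_eq_0 dvd_trans by blast
  then show ?thesis
    unfolding nilpotent_def newton_seq_eq_alg_eval alg_eval_power alg_eval_diff alg_eval_X by blast
qed

lemma Jordan_Chevalley_newton_seq:
  assumes "separable_poly f" "alg_eval scale (f * g) u = 0" "f * g dvd f ^ (2 ^ n)"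
    and "[q * pderiv f = 1] (mod g)"
  shows "Jordan_Chevalley scale u (newton_seq scale f q u n) (u - newton_seq scale f q u n)"
proof -
  let ?d = "newton_seq scale f q u n"
  have "absolutely_semisimple scale ?d"
    using assms alg_eval_newton_seq_eq_0 unfolding absolutely_semisimple_def by blast
  moreover have "nilpotent (u - ?d)" using assms(2,3) by (rule nilpotent_diff_newton_seq)
  moreover have "u * ?d = ?d * u" unfolding newton_seq_eq_alg_eval by (simp add: alg_eval_commute)
  then have "commutator ?d (u - ?d) = 0" by (simp add: commutator_def algebra_simps)
  ultimately show ?thesis by (simp add: Jordan_Chevalley_def)
qed

lemma absolutely_semisimple_nilpotent_alg_eval:
  assumes "absolutely_semisimple scale d" "nilpotent (alg_eval scale f d)"
  shows "alg_eval scale f d = 0"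
proof -
  obtain g where g: "separable_poly g" "alg_eval scale g d = 0"
    using assms(1) by (auto simp: absolutely_semisimple_def)
  obtain n where n: "alg_eval scale f d ^ n = 0" using assms(2) by (auto simp: nilpotent_def)
  obtain t g' h x y where t: "g = t * g'" "f ^ n = t * h" and xy: "x * g' + y * h = 1"
    using bezout_cofactors[of g "f ^ n"] by blast
  have "t = x * g + y * f ^ n"
    using xy by (metis t distrib_left mult.left_commute mult_1_right)
  then have "alg_eval scale t d = 0"
    by (simp add: alg_eval_add alg_eval_mult alg_eval_power g(2) n)
  moreover have "squarefree t"
    using separable_poly_imp_squarefree[OF g(1)] squarefree_mono[of t g] t(1) by simp
  then have "t dvd f" by (rule squarefree_dvd_power_imp_dvd[where n = n]) (simp add: t(2))
  ultimately show ?thesis by (rule alg_eval_dvd_eq_0)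
qed

lemma separable_poly_root_nilpotent_diff_eq_0:
  assumes "separable_poly f" "alg_eval scale f d = 0" "alg_eval scale f (d + e) = 0"
    and "d * e = e * d" "nilpotent e"
  shows "e = 0"
proof -
  obtain w where "alg_eval scale f (d + e)
      = alg_eval scale f d + e * alg_eval scale (pderiv f) d + e\<^sup>2 * w"
    using alg_eval_taylor[OF assms(4)] by blast
  then have taylor: "e * alg_eval scale (pderiv f) d = - (e\<^sup>2 * w)"
    by (simp add: assms(2,3) eq_neg_iff_add_eq_0)
  obtain x y where "x * f + y * pderiv f = 1"
    using assms(1) by (auto simp: separable_poly_def coprime_iff_bezout)
  then have "alg_eval scale (f * x + pderiv f * y) d = 1" by (simp add: mult.commute alg_eval_1)
  then have "alg_eval scale (pderiv f) d * alg_eval scale y d = 1"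
    by (simp add: alg_eval_add alg_eval_mult assms(2))
  then have "e = - (e\<^sup>2 * w) * alg_eval scale y d" using taylor by (metis mult.assoc mult_1_right)
  also have "\<dots> = e\<^sup>2 * (- (w * alg_eval scale y d))" by (simp add: mult.assoc)
  finally show ?thesis using assms(5) nilpotent_eq_0_if_eq_square_mult by blast
qed

lemma absolutely_semisimple_eq_if_nilpotent_diff:
  assumes "absolutely_semisimple scale d" "absolutely_semisimple scale d'"
    and "d * d' = d' * d" "nilpotent (d' - d)"
  shows "d' = d"
proof -
  define e where "e = d' - d"
  have comm: "d * e = e * d" and nil: "nilpotent e" and d': "d' = d + e"
    using assms(3,4) by (simp_all add: e_def algebra_simps)
  obtain f where f: "separable_poly f" "alg_eval scale f d = 0"
    using assms(1) by (auto simp: absolutely_semisimple_def)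
  let ?f' = "alg_eval scale (pderiv f) d"
  obtain w where w: "e * w = w * e" "alg_eval scale f d' = e * ?f' + e\<^sup>2 * w"
    using alg_eval_taylor[OF comm, of f] f(2) d' by auto
  have "e * ?f' = ?f' * e" using comm by (intro alg_eval_commute) simp
  then have "e * (?f' + e * w) = (?f' + e * w) * e"
    by (simp add: distrib_left distrib_right mult.assoc flip: w(1))
  then have "nilpotent (e * (?f' + e * w))" using nil nilpotent_mult_commuting by blast
  also have "e * (?f' + e * w) = alg_eval scale f d'"
    by (simp add: w(2) power2_eq_square distrib_left mult.assoc)
  finally have "alg_eval scale f (d + e) = 0"
    using assms(2) absolutely_semisimple_nilpotent_alg_eval unfolding d' by blast
  then have "e = 0" using f comm nil separable_poly_root_nilpotent_diff_eq_0 by blast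
  then show ?thesis by (simp add: d')
qed

lemma Jordan_Chevalley_unique:
  assumes "Jordan_Chevalley scale u (alg_eval scale f u) s" "Jordan_Chevalley scale u d' s'"
  shows "d' = alg_eval scale f u \<and> s' = s"
proof -
  let ?d = "alg_eval scale f u"
  have u: "u = ?d + s" "u = d' + s'" and comm: "d' * s' = s' * d'"
    using assms unfolding Jordan_Chevalley_def commutator_def by auto
  have "d' * u = u * d'" "s' * u = u * s'"
    unfolding u(2) using comm by (simp_all add: algebra_simps)
  then have d'd: "d' * ?d = ?d * d'" and s'd: "s' * ?d = ?d * s'" and s'u: "s' * u = u * s'"
    by (simp_all add: alg_eval_commute)
  have s: "s = u - ?d" using u(1) by (simp add: algebra_simps)
  have "s * s' = s' * s" unfolding s by (simp add: left_diff_distrib right_diff_distrib s'd s'u)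
  then have "nilpotent (s - s')"
    using assms nilpotent_diff_commuting unfolding Jordan_Chevalley_def by blast
  also have "s - s' = d' - ?d" using s u(2) by (simp add: algebra_simps)
  finally have "d' = ?d"
    using assms d'd absolutely_semisimple_eq_if_nilpotent_diff
    unfolding Jordan_Chevalley_def by metis
  then show ?thesis using s u(2) by (simp add: algebra_simps)
qed

end

theorem theorem1:
  fixes scale :: "'k::field \<Rightarrow> 'a::{ring, monoid_mult} \<Rightarrow> 'a"
    and u :: 'a
    and p pt pb :: "'k poly"
    and ps :: "nat \<Rightarrow> 'k poly"
    and ms :: "nat \<Rightarrow> nat"
    and r m N :: nat
  assumes "unital_algebra scale"
    and "separable_element scale u"
    and "lead_coeff p = 1"
    and "alg_eval scale p u = 0"
    and "r \<ge> 1"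
    and "p = (\<Prod>j\<in>{1..r}. ps j ^ ms j)"
    and "inj_on ps {1..r}"
    and "\<And>j. j \<in> {1..r} \<Longrightarrow> irreducible (ps j)"
    and "\<And>j. j \<in> {1..r} \<Longrightarrow> lead_coeff (ps j) = 1"
    and "\<And>j. j \<in> {1..r} \<Longrightarrow> separable_poly (ps j)"
    and "\<And>j. j \<in> {1..r} \<Longrightarrow> ms j \<ge> 1"
    and "m = Max (ms ` {1..r})"
    and "pt = (\<Prod>j\<in>{1..r}. ps j)"
    and "pb = p div pt"
    and "N = (LEAST n. 2 ^ n \<ge> m)"
  shows "separable_poly pt \<and>
    (\<exists>q. [q * pderiv pt = 1] (mod pb)) \<and>
    (\<forall>q. [q * pderiv pt = 1] (mod pb) \<longrightarrow>
      (let d = newton_seq scale pt q u in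
        alg_eval scale pt (d N) = 0 \<and>
        absolutely_semisimple scale (d N) \<and>
        nilpotent (u - d N) \<and>
        commutator (d N) (u - d N) = 0 \<and>
        Jordan_Chevalley scale u (d N) (u - d N) \<and>
        (\<forall>d' s'. Jordan_Chevalley scale u d' s' \<longrightarrow> d' = d N \<and> s' = u - d N)))"
proof -
  interpret unital_algebra scale by fact
  note p_def = assms(6) and m_def = assms(12) and pt_def = assms(13)
  have "coprime (ps i) (ps j)" if "i \<in> {1..r}" "j \<in> {1..r}" "i \<noteq> j" for i j
    using that assms(7-9) by (intro coprime_monic_irreducible) (auto dest: inj_onD)
  then have sep: "separable_poly pt"
    unfolding pt_def using assms(5,10) by (intro separable_poly_prod) auto
  have "pt dvd p"
    unfolding p_def pt_def by (intro prod_dvd_prod dvd_power) (use assms(11) in force)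
  then have p_eq: "p = pt * pb" by (simp add: assms(14))
  have "m \<le> 2 ^ N" unfolding assms(15) by (rule LeastI[of _ m]) (simp add: less_imp_le)
  moreover have "ms j \<le> m" if "j \<in> {1..r}" for j unfolding m_def using that by simp
  ultimately have "p dvd pt ^ (2 ^ N)"
    unfolding p_def pt_def prod_power_distrib
    by (intro prod_dvd_prod le_imp_power_dvd) (blast intro: le_trans)
  then have dvd: "pt * pb dvd pt ^ (2 ^ N)" and root: "alg_eval scale (pt * pb) u = 0"
    using p_eq assms(4) by simp_all
  have "\<exists>q. [q * pderiv pt = 1] (mod pb)"
    using sep dvd_mult_right[OF dvd] by (rule separable_poly_ex_inverse_pderiv_cong)
  moreover have "alg_eval scale pt (newton_seq scale pt q u N) = 0"
    "Jordan_Chevalley scale u (newton_seq scale pt q u N) (u - newton_seq scale pt q u N)"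
    if "[q * pderiv pt = 1] (mod pb)" for q
    using alg_eval_newton_seq_eq_0[OF root dvd that] Jordan_Chevalley_newton_seq[OF sep root dvd that]
    by blast+
  ultimately show ?thesis
    using sep Jordan_Chevalley_unique
    unfolding Let_def newton_seq_eq_alg_eval Jordan_Chevalley_def by blast
qed

end
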